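(* Let $(X,d)$ and $(Y,e)$ be metric spaces, $E\subseteq X$, $f:E\to Y$. Let $K,L\subseteq\mathbb N$ and $\alpha:K\to X$, $\beta:L\to Y$ with $\mathrm{rng}(\alpha)$ dense in $X$ and $\mathrm{rng}(\beta)$ dense in $Y$; let $r_0,r_1,\ldots$ be a computable sequence of positive rationals having $0$ as an accumulation point; let $\langle\cdot,\cdot\rangle:\mathbb N^2\to\mathbb N$ be a computable bijection, $I=\{\langle k,m\rangle\mid k\in K,m\in\mathbb N\}$, $J=\{\langle l,n\rangle\mid l\in L,n\in\mathbb N\}$, $U_{\langle k,m\rangle}=B_d(\alpha(k),r_m)$, $V_{\langle l,n\rangle}=B_e(\beta(l),r_n)$, $\mathcal U=\{U_i\}_{i\in I}$, $\mathcal V=\{V_j\}_{j\in J}$. Suppose $(X,d,\alpha)$ is a semi-computable metric space and $L$ is recursively enumerable. If $f$ is $(\mathcal U,\mathcal V)$-computable, then there exists a recursively enumerable topological $(\alpha,\beta)$-approximation system for $f$.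
   Context: $B_d(x,r)=\{\bar x\in X\mid d(x,\bar x)<r\}$, similarly $B_e$. A semi-computable metric space is a triple $(Z,\rho,\gamma)$ where $(Z,\rho)$ is a metric space, $\gamma$ is a partial map from $\mathbb N$ to $Z$ with $\mathrm{rng}(\gamma)$ dense in $Z$, and the set $\{(l,l',p,q)\mid l,l'\in\mathrm{dom}(\gamma),\ p,q\in\mathbb N\setminus\{0\},\ \rho(\gamma(l),\gamma(l'))<p/q\}$ is recursively enumerable (here $\alpha$ is regarded as a partial map $\mathbb N\to X$ with domain $K$). A topological $(\alpha,\beta)$-approximation system for $f$ is a subset $S\subseteq K\times\mathbb N\times L\times\mathbb N$ such that for every $x\in E$ and every $(l,n)\in L\times\mathbb N$: $e(\beta(l),f(x))<r_n$ iff there exist $k,m$ with $(k,m,l,n)\in S$ and $d(\alpha(k),x)<r_m$. For $x\in X$ let $[x]_{\mathcal U}=\{i\in I\mid x\in U_i\}$, for $y\in Y$ let $[y]_{\mathcal V}=\{j\in J\mid y\in V_j\}$; $f$ is $(\mathcal U,\mathcal V)$-computable if there is an enumeration operator $F:\mathcal P(\mathbb N)\to\mathcal P(\mathbb N)$ with $[f(x)]_{\mathcal V}=F([x]_{\mathcal U})$ for all $x\in E$. *)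

theory Defs
  imports "HOL-Analysis.Analysis" "HOL-Library.Nat_Bijection"
begin

text \<open>
  \<open>recursive k f\<close>: the total \<open>k\<close>-ary function \<open>f\<close> is (general) recursive. The arguments are given
  as a list of length \<open>k\<close>; by rule \<open>ext\<close> the values of \<open>f\<close> on lists of other lengths are irrelevant.
  Minimization is only applied to regular functions, so that no partial functions are needed.
\<close>

inductive recursive :: "nat \<Rightarrow> (nat list \<Rightarrow> nat) \<Rightarrow> bool" where
  zero: "recursive k (\<lambda>_. 0)"
| succ: "recursive 1 (\<lambda>xs. Suc (xs ! 0))"
| proj: "i < k \<Longrightarrow> recursive k (\<lambda>xs. xs ! i)"
| comp: "recursive (length gs) h \<Longrightarrow> \<forall>g\<in>set gs. recursive k g \<Longrightarrow>
    recursive k (\<lambda>xs. h (map (\<lambda>g. g xs) gs))"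
| prim_rec: "recursive k g \<Longrightarrow> recursive (Suc (Suc k)) h \<Longrightarrow>
    recursive (Suc k) (\<lambda>xs. rec_nat (g (tl xs)) (\<lambda>n r. h (n # r # tl xs)) (hd xs))"
| mu: "recursive (Suc k) g \<Longrightarrow> \<forall>xs. length xs = k \<longrightarrow> (\<exists>y. g (y # xs) = 0) \<Longrightarrow>
    recursive k (\<lambda>xs. LEAST y. g (y # xs) = 0)"
| ext: "recursive k f \<Longrightarrow> \<forall>xs. length xs = k \<longrightarrow> g xs = f xs \<Longrightarrow> recursive k g"

text \<open>
  A \<open>k\<close>-ary relation on the natural numbers, given as a set of lists of length \<open>k\<close>, is recursively
  enumerable if it is empty or the range of a recursive function from \<open>\<nat>\<close> to \<open>\<nat>\<^sup>k\<close>;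
  the members of \<open>gs\<close> are the components of that function.
\<close>

definition recursively_enumerable :: "nat \<Rightarrow> nat list set \<Rightarrow> bool" where
  "recursively_enumerable k A \<longleftrightarrow>
     A = {} \<or>
     (\<exists>gs. length gs = k \<and> (\<forall>g\<in>set gs. recursive 1 g) \<and>
           A = range (\<lambda>t. map (\<lambda>g. g [t]) gs))"

definition computable_pos_rat_seq :: "(nat \<Rightarrow> rat) \<Rightarrow> bool" where
  "computable_pos_rat_seq r \<longleftrightarrow>
     (\<exists>p q. recursive 1 p \<and> recursive 1 q \<and>
        (\<forall>n. 0 < p [n] \<and> 0 < q [n] \<and> r n = of_nat (p [n]) / of_nat (q [n])))"

text \<open>
  Finite sets of natural numbers enter through their canonical indices:
  \<open>set_decode u\<close> is the set of positions of the digit 1 in the binary expansion of \<open>u\<close>.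
\<close>

definition enumeration_operator :: "(nat set \<Rightarrow> nat set) \<Rightarrow> bool" where
  "enumeration_operator F \<longleftrightarrow>
     (\<exists>W. recursively_enumerable 2 W \<and>
        (\<forall>A. F A = {n. \<exists>u. [n, u] \<in> W \<and> set_decode u \<subseteq> A}))"

definition dense_in_metric :: "'a set \<Rightarrow> ('a \<Rightarrow> 'a \<Rightarrow> real) \<Rightarrow> 'a set \<Rightarrow> bool" where
  "dense_in_metric Z \<rho> A \<longleftrightarrow> A \<subseteq> Z \<and> Metric_space.mtopology Z \<rho> closure_of A = Z"

text \<open>The partial map \<open>\<gamma>\<close> from \<open>\<nat>\<close> to \<open>Z\<close> is given by its domain \<open>D\<close> and its values on \<open>D\<close>.\<close>

definition semi_computable_metric_space ::
  "'a set \<Rightarrow> ('a \<Rightarrow> 'a \<Rightarrow> real) \<Rightarrow> nat set \<Rightarrow> (nat \<Rightarrow> 'a) \<Rightarrow> bool" where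
  "semi_computable_metric_space Z \<rho> D \<gamma> \<longleftrightarrow>
     Metric_space Z \<rho> \<and> \<gamma> \<in> D \<rightarrow> Z \<and> dense_in_metric Z \<rho> (\<gamma> ` D) \<and>
     recursively_enumerable 4
       {[l, l', p, q] | l l' p q. l \<in> D \<and> l' \<in> D \<and> 0 < p \<and> 0 < q \<and>
          \<rho> (\<gamma> l) (\<gamma> l') < real p / real q}"

definition topological_approximation_system ::
  "('a \<Rightarrow> 'a \<Rightarrow> real) \<Rightarrow> ('b \<Rightarrow> 'b \<Rightarrow> real) \<Rightarrow> nat set \<Rightarrow> (nat \<Rightarrow> 'a) \<Rightarrow> nat set \<Rightarrow> (nat \<Rightarrow> 'b) \<Rightarrow>
   (nat \<Rightarrow> rat) \<Rightarrow> 'a set \<Rightarrow> ('a \<Rightarrow> 'b) \<Rightarrow> (nat \<times> nat \<times> nat \<times> nat) set \<Rightarrow> bool" where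
  "topological_approximation_system d e K \<alpha> L \<beta> r E f S \<longleftrightarrow>
     S \<subseteq> K \<times> UNIV \<times> L \<times> UNIV \<and>
     (\<forall>x\<in>E. \<forall>l\<in>L. \<forall>n.
        e (\<beta> l) (f x) < of_rat (r n) \<longleftrightarrow>
        (\<exists>k m. (k, m, l, n) \<in> S \<and> d (\<alpha> k) x < of_rat (r m)))"

definition indices_at :: "nat set \<Rightarrow> (nat \<Rightarrow> 'a set) \<Rightarrow> 'a \<Rightarrow> nat set" where
  "indices_at I U x = {i \<in> I. x \<in> U i}"

definition computable_wrt ::
  "nat set \<Rightarrow> (nat \<Rightarrow> 'a set) \<Rightarrow> nat set \<Rightarrow> (nat \<Rightarrow> 'b set) \<Rightarrow> 'a set \<Rightarrow> ('a \<Rightarrow> 'b) \<Rightarrow> bool" where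
  "computable_wrt I U J V E f \<longleftrightarrow>
     (\<exists>F. enumeration_operator F \<and> (\<forall>x\<in>E. indices_at J V (f x) = F (indices_at I U x)))"

end

theory Submission
  imports Defs
begin

text \<open>
  Let \<open>W\<close> be the recursively enumerable set defining the enumeration operator. Put
  \<open>(k, m, l, n)\<close> into \<open>S\<close> if some pair \<open>(\<langle>l, n\<rangle>, u)\<close> in \<open>W\<close> is such that the ball
  \<open>B(\<alpha> k, r\<^sub>m)\<close> lies formally inside \<open>U\<^sub>i\<close> for each \<open>i\<close> in the finite set with index \<open>u\<close>,
  where for \<open>i = \<langle>k', m'\<rangle>\<close> this means \<open>d (\<alpha> k) (\<alpha> k') < r\<^sub>m\<^sub>' - r\<^sub>m\<close>. Formal inclusion implies
  inclusion, and a point of finitely many \<open>U\<^sub>i\<close> lies in a ball formally inside all of them, by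
  density. Formal inclusion is a semi-decidable relation because the space is
  semi-computable, and semi-decidable relations are closed under bounded universal quantification.
\<close>

section \<open>Recursive functions\<close>

text \<open>Rule \<open>ext\<close> frees composition from the literal shape of its conclusion:
  \<open>f\<close> only has to agree with the composite on lists of length \<open>k\<close>.\<close>

lemma recursive_comp_list:
  assumes "recursive (length gs) h" "\<forall>g\<in>set gs. recursive k g"
    and "\<And>xs. length xs = k \<Longrightarrow> f xs = h (map (\<lambda>g. g xs) gs)"
  shows "recursive k f"
  using recursive.ext[OF recursive.comp[OF assms(1,2)]] assms(3) by blast

lemma recursive_comp1:
  "recursive 1 h \<Longrightarrow> recursive k f \<Longrightarrow> recursive k (\<lambda>xs. h [f xs])"
  by (rule recursive_comp_list[of "[f]" h]) auto

lemma recursive_comp2: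
  "recursive 2 h \<Longrightarrow> recursive k f \<Longrightarrow> recursive k g \<Longrightarrow> recursive k (\<lambda>xs. h [f xs, g xs])"
  by (rule recursive_comp_list[of "[f, g]" h]) (auto simp: numeral_2_eq_2)

lemma recursive_Suc: "recursive k f \<Longrightarrow> recursive k (\<lambda>xs. Suc (f xs))"
  using recursive_comp1[OF recursive.succ] by simp

lemma recursive_const: "recursive k (\<lambda>_. c)"
  by (induction c) (auto intro: recursive.zero recursive_Suc)

text \<open>The entries of \<open>drop n xs\<close> are the projections at \<open>n + i\<close>, so
  this is an ordinary composition. With \<open>gs\<close> empty it discards leading arguments, with
  \<open>n = 0\<close> it adds computed ones, and otherwise it replaces them.\<close>

lemma recursive_prepend_drop:
  assumes "recursive (length gs + k) f" "\<forall>g\<in>set gs. recursive (n + k) g"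
  shows "recursive (n + k) (\<lambda>xs. f (map (\<lambda>g. g xs) gs @ drop n xs))"
proof (rule recursive_comp_list)
  let ?ps = "map (\<lambda>i xs. xs ! (n + i)) [0..<k] :: (nat list \<Rightarrow> nat) list"
  show "recursive (length (gs @ ?ps)) f"
    using assms(1) by simp
  show "\<forall>g\<in>set (gs @ ?ps). recursive (n + k) g"
    using assms(2) by (auto intro: recursive.proj)
  show "f (map (\<lambda>g. g xs) gs @ drop n xs) = f (map (\<lambda>g. g xs) (gs @ ?ps))"
    if "length xs = n + k" for xs
  proof -
    have "drop n xs = map (\<lambda>g. g xs) ?ps"
      using that by (intro nth_equalityI) auto
    then show ?thesis by simp
  qed
qed

lemma recursive_tl: "recursive k f \<Longrightarrow> recursive (Suc k) (\<lambda>xs. f (tl xs))"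
  using recursive_prepend_drop[of "[]" k f 1] by (simp add: drop_Suc)

text \<open>Rule \<open>prim_rec\<close> reads the number of iterations from the head of the list;
  prepending \<open>b xs\<close> lets it be computed from the parameters.\<close>

lemma recursive_rec_nat:
  assumes "recursive k g" "recursive (Suc (Suc k)) h" "recursive k b"
  shows "recursive k (\<lambda>xs. rec_nat (g xs) (\<lambda>n r. h (n # r # xs)) (b xs))"
  using recursive_prepend_drop[of "[b]" k _ 0, simplified, OF recursive.prim_rec[OF assms(1,2)]]
    assms(3) by simp

section \<open>Arithmetic operations\<close>

lemma recursive_add:
  assumes "recursive k f" "recursive k g"
  shows "recursive k (\<lambda>xs. f xs + g xs)"
proof -
  have "rec_nat a (\<lambda>n r. Suc r) b = a + b" for a b by (induction b) auto
  then show ?thesis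
    using recursive_rec_nat[OF assms(1) recursive_Suc[OF recursive.proj[of 1]] assms(2)] by simp
qed

lemma recursive_mult:
  assumes "recursive k f" "recursive k g"
  shows "recursive k (\<lambda>xs. f xs * g xs)"
proof -
  have "rec_nat 0 (\<lambda>n r. r + a) b = a * b" for a b :: nat by (induction b) auto
  moreover have "recursive (Suc (Suc k)) (\<lambda>xs. xs ! 1 + f (tl (tl xs)))"
    by (intro recursive_add recursive.proj recursive_tl[of "Suc k" "\<lambda>xs. f (tl xs)"]
        recursive_tl assms) simp
  ultimately show ?thesis
    using recursive_rec_nat[OF recursive.zero _ assms(2)] by fastforce
qed

text \<open>The predecessor is a recursion that returns its counter and ignores the accumulated
  value; iterating it gives truncated subtraction.\<close>

lemma recursive_diff:
  assumes "recursive k f" "recursive k g"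
  shows "recursive k (\<lambda>xs. f xs - g xs)"
proof -
  have "rec_nat 0 (\<lambda>n r. n) b = b - 1" for b by (cases b) auto
  then have pred: "recursive k (\<lambda>xs. f xs - 1)" if "recursive k f" for k f
    using recursive_rec_nat[OF recursive.zero recursive.proj[of 0] that] by simp
  have "rec_nat a (\<lambda>n r. r - 1) b = a - b" for a b by (induction b) auto
  then show ?thesis
    using recursive_rec_nat[OF assms(1) pred[OF recursive.proj[of 1]] assms(2)] by simp
qed

lemma recursive_power:
  assumes "recursive k g"
  shows "recursive k (\<lambda>xs. c ^ g xs)"
proof -
  have "rec_nat 1 (\<lambda>n r. r * c) b = c ^ b" for b by (induction b) auto
  moreover have "recursive (Suc (Suc k)) (\<lambda>xs. xs ! 1 * c)"
    by (intro recursive_mult recursive.proj recursive_const) simp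
  ultimately show ?thesis
    using recursive_rec_nat[OF recursive_const[of k 1] _ assms] by fastforce
qed

section \<open>Decidable predicates\<close>

text \<open>The value 0 stands for truth. This is the convention of rule \<open>mu\<close>; it also
  makes conjunction a sum and \<open>\<le>\<close> a truncated difference.\<close>

definition decidable :: "nat \<Rightarrow> (nat list \<Rightarrow> bool) \<Rightarrow> bool" where
  "decidable k P \<longleftrightarrow> (\<exists>c. recursive k c \<and> (\<forall>xs. length xs = k \<longrightarrow> (P xs \<longleftrightarrow> c xs = 0)))"

lemma decidableI:
  "recursive k c \<Longrightarrow> (\<And>xs. length xs = k \<Longrightarrow> P xs \<longleftrightarrow> c xs = 0) \<Longrightarrow> decidable k P"
  unfolding decidable_def by blast

lemma decidable_const: "decidable k (\<lambda>_. b)"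
  by (rule decidableI[OF recursive_const[of k "if b then 0 else 1"]]) auto

lemma decidable_le:
  "recursive k f \<Longrightarrow> recursive k g \<Longrightarrow> decidable k (\<lambda>xs. f xs \<le> g xs)"
  by (rule decidableI[OF recursive_diff]) auto

lemma decidable_conj:
  assumes "decidable k P" "decidable k Q"
  shows "decidable k (\<lambda>xs. P xs \<and> Q xs)"
proof -
  obtain c c' where "recursive k c" "\<And>xs. length xs = k \<Longrightarrow> P xs \<longleftrightarrow> c xs = 0"
    "recursive k c'" "\<And>xs. length xs = k \<Longrightarrow> Q xs \<longleftrightarrow> c' xs = 0"
    using assms unfolding decidable_def by blast
  then show ?thesis by (intro decidableI[OF recursive_add[of k c c']]) auto
qed

lemma decidable_not:
  assumes "decidable k P"
  shows "decidable k (\<lambda>xs. \<not> P xs)"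
proof -
  obtain c where "recursive k c" "\<And>xs. length xs = k \<Longrightarrow> P xs \<longleftrightarrow> c xs = 0"
    using assms unfolding decidable_def by blast
  then show ?thesis by (intro decidableI[OF recursive_diff[OF recursive_const[of k 1]]]) auto
qed

lemma decidable_disj:
  "decidable k P \<Longrightarrow> decidable k Q \<Longrightarrow> decidable k (\<lambda>xs. P xs \<or> Q xs)"
  using decidable_not[OF decidable_conj[OF decidable_not decidable_not]] by simp

lemma decidable_eq:
  "recursive k f \<Longrightarrow> recursive k g \<Longrightarrow> decidable k (\<lambda>xs. f xs = g xs)"
  using decidable_conj[OF decidable_le decidable_le] by (simp add: eq_iff)

lemma decidable_prepend_drop:
  assumes "decidable (length gs + k) P" "\<forall>g\<in>set gs. recursive (n + k) g"
  shows "decidable (n + k) (\<lambda>xs. P (map (\<lambda>g. g xs) gs @ drop n xs))"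
proof -
  obtain c where "recursive (length gs + k) c"
    "\<And>xs. length xs = length gs + k \<Longrightarrow> P xs \<longleftrightarrow> c xs = 0"
    using assms unfolding decidable_def by blast
  then show ?thesis
    using assms(2) by (intro decidableI[OF recursive_prepend_drop]) auto
qed

text \<open>The recursion computes the product of the values \<open>c (y # xs)\<close> over
  \<open>y < b\<close>, starting from 1; it vanishes iff one of the factors does.\<close>

lemma decidable_bex:
  assumes "decidable (Suc k) P" "recursive k b"
  shows "decidable k (\<lambda>xs. \<exists>y<b xs. P (y # xs))"
proof -
  obtain c where c: "recursive (Suc k) c"
    and P: "\<And>xs. length xs = Suc k \<Longrightarrow> P xs \<longleftrightarrow> c xs = 0"
    using assms(1) unfolding decidable_def by blast
  \<comment> \<open>The list \<open>ys\<close> is \<open>n # r # xs\<close> with counter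
    \<open>n\<close> and partial product \<open>r\<close>; the new factor is
    \<open>c (n # xs)\<close>, so \<open>r\<close> must be cut out.\<close>
  let ?h = "\<lambda>ys. ys ! 1 * c (hd ys # tl (tl ys))"
  have "recursive (2 + k) (\<lambda>ys. c (hd ys # tl (tl ys)))"
  proof (rule recursive.ext)
    show "recursive (2 + k) (\<lambda>ys. c (map (\<lambda>g. g ys) [\<lambda>ys. ys ! 0] @ drop 2 ys))"
      using c by (intro recursive_prepend_drop) (auto intro: recursive.proj)
    show "\<forall>xs. length xs = 2 + k \<longrightarrow>
        c (hd xs # tl (tl xs)) = c (map (\<lambda>g. g xs) [\<lambda>ys. ys ! 0] @ drop 2 xs)"
      by (auto simp: drop_Suc numeral_2_eq_2 length_Suc_conv)
  qed
  then have "recursive (Suc (Suc k)) ?h"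
    by (intro recursive_mult recursive.proj) auto
  then show ?thesis
  proof (rule decidableI[OF recursive_rec_nat[OF recursive_const _ assms(2)]])
    fix xs :: "nat list" assume "length xs = k"
    then have "(\<exists>y<b. P (y # xs)) \<longleftrightarrow> rec_nat 1 (\<lambda>n r. ?h (n # r # xs)) b = 0" for b
      by (induction b) (auto simp: P less_Suc_eq)
    then show "(\<exists>y<b xs. P (y # xs)) \<longleftrightarrow> rec_nat 1 (\<lambda>n r. ?h (n # r # xs)) (b xs) = 0" .
  qed
qed

lemma decidable_ball:
  "decidable (Suc k) P \<Longrightarrow> recursive k b \<Longrightarrow> decidable k (\<lambda>xs. \<forall>y<b xs. P (y # xs))"
  using decidable_not[OF decidable_bex[OF decidable_not]] by simp

lemma recursive_if:
  assumes "decidable k P" "recursive k f" "recursive k g"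
  shows "recursive k (\<lambda>xs. if P xs then f xs else g xs)"
proof -
  obtain c where c: "recursive k c" and P: "\<And>xs. length xs = k \<Longrightarrow> P xs \<longleftrightarrow> c xs = 0"
    using assms(1) unfolding decidable_def by blast
  \<comment> \<open>By truncation, \<open>1 - c xs\<close> is 1 if \<open>P xs\<close> holds and 0
    otherwise; the other factor is its complement.\<close>
  have "recursive k (\<lambda>xs. f xs * (1 - c xs) + g xs * (1 - (1 - c xs)))"
    by (intro recursive_add recursive_mult recursive_diff recursive_const c assms)
  then show ?thesis
    by (rule recursive.ext) (auto simp: P)
qed

lemma recursive_Least:
  assumes "decidable (Suc k) P" "\<And>xs. length xs = k \<Longrightarrow> \<exists>y. P (y # xs)"
  shows "recursive k (\<lambda>xs. LEAST y. P (y # xs))"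
proof -
  obtain c where c: "recursive (Suc k) c"
    and P: "\<And>xs. length xs = Suc k \<Longrightarrow> P xs \<longleftrightarrow> c xs = 0"
    using assms(1) unfolding decidable_def by blast
  have "recursive k (\<lambda>xs. LEAST y. c (y # xs) = 0)"
    using assms(2) by (intro recursive.mu[OF c]) (auto simp: P)
  then show ?thesis
    by (rule recursive.ext) (auto simp: P)
qed

section \<open>Finite sets given by canonical indices\<close>

text \<open>Digit \<open>i\<close> of \<open>u\<close> is 1 iff \<open>u\<close> splits into higher
  digits \<open>a\<close>, this digit, and a remainder \<open>b < 2 ^ i\<close>. Only bounded
  quantifiers and arithmetic already known to be recursive occur on the right.\<close>

lemma mem_set_decode_iff:
  "i \<in> set_decode u \<longleftrightarrow> (\<exists>a<Suc u. \<exists>b<2 ^ i. u = (2 * a + 1) * 2 ^ i + b)"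
proof
  assume "i \<in> set_decode u"
  then have "odd (u div 2 ^ i)" by (simp add: set_decode_def)
  then obtain a where a: "u div 2 ^ i = 2 * a + 1" by (elim oddE)
  then have "u = (2 * a + 1) * 2 ^ i + u mod 2 ^ i"
    by (metis div_mult_mod_eq)
  moreover have "a < Suc u"
    using a div_le_dividend[of u "2 ^ i"] by linarith
  ultimately show "\<exists>a<Suc u. \<exists>b<2 ^ i. u = (2 * a + 1) * 2 ^ i + b"
    by (meson mod_less_divisor zero_less_numeral zero_less_power)
next
  assume "\<exists>a<Suc u. \<exists>b<2 ^ i. u = (2 * a + 1) * 2 ^ i + b"
  then obtain a b where "b < 2 ^ i" "u = b + (2 * a + 1) * 2 ^ i" by auto
  then have "u div 2 ^ i = 2 * a + 1"
    by (simp only: div_mult_self1) simp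
  then show "i \<in> set_decode u" by (simp add: set_decode_def)
qed

text \<open>A member \<open>i\<close> contributes \<open>2 ^ i > i\<close> to \<open>u\<close>.
  Hence a quantifier over \<open>set_decode u\<close> can be bounded by \<open>u\<close>
  itself.\<close>

lemma less_if_mem_set_decode:
  assumes "i \<in> set_decode u" shows "i < u"
proof -
  obtain a b where "u = (2 * a + 1) * 2 ^ i + b"
    using assms by (auto simp: mem_set_decode_iff)
  then have "2 ^ i \<le> u" by simp
  then show ?thesis using less_exp[of i] by linarith
qed

lemma decidable_mem_set_decode:
  assumes "recursive k f" "recursive k g"
  shows "decidable k (\<lambda>xs. f xs \<in> set_decode (g xs))"
proof -
  \<comment> \<open>The arguments are \<open>b\<close>, \<open>a\<close> and then the original list,
    which \<open>tl (tl xs)\<close> recovers.\<close>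
  have "decidable (Suc (Suc k)) (\<lambda>xs. g (tl (tl xs)) =
      (2 * xs ! 1 + 1) * 2 ^ f (tl (tl xs)) + xs ! 0)"
    by (intro decidable_eq recursive_add recursive_mult recursive_power recursive.proj recursive_const
        recursive_tl[of "Suc k" "\<lambda>xs. f (tl xs)"] recursive_tl[of "Suc k" "\<lambda>xs. g (tl xs)"]
        recursive_tl assms) auto
  then have "decidable (Suc k) (\<lambda>xs. \<exists>b<2 ^ f (tl xs). g (tl (tl (b # xs))) =
      (2 * (b # xs) ! 1 + 1) * 2 ^ f (tl (tl (b # xs))) + (b # xs) ! 0)"
    by (rule decidable_bex) (intro recursive_power recursive_tl assms)
  then have "decidable k (\<lambda>xs. \<exists>a<Suc (g xs). \<exists>b<2 ^ f (tl (a # xs)). g (tl (tl (b # a # xs))) =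
      (2 * (b # a # xs) ! 1 + 1) * 2 ^ f (tl (tl (b # a # xs))) + (b # a # xs) ! 0)"
    by (rule decidable_bex) (intro recursive_Suc assms)
  then show ?thesis
    by (simp add: mem_set_decode_iff)
qed

section \<open>Recursive coding of tuples\<close>

text \<open>The code of \<open>(m, n)\<close> is \<open>triangle (m + n) + m\<close>, and triangular
  numbers arise by adding \<open>Suc n\<close> at stage \<open>n\<close>.\<close>

lemma recursive_prod_encode:
  assumes "recursive k f" "recursive k g"
  shows "recursive k (\<lambda>xs. prod_encode (f xs, g xs))"
proof -
  have tri: "rec_nat 0 (\<lambda>n r. r + Suc n) b = triangle b" for b by (induction b) auto
  have "recursive (Suc (Suc k)) (\<lambda>xs. xs ! 1 + Suc (xs ! 0))" for k
    by (intro recursive_add recursive_Suc recursive.proj) auto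
  from recursive_rec_nat[OF recursive.zero this recursive_add[OF assms]]
  have "recursive k (\<lambda>xs. triangle (f xs + g xs))"
    by (simp add: tri del: add_Suc_right)
  then show ?thesis
    by (simp add: prod_encode_def recursive_add assms)
qed

text \<open>Each component is found by minimization. The other one needs only a bounded search,
  since no component exceeds the code.\<close>

lemma recursive_prod_decode:
  shows recursive_fst_prod_decode: "recursive 1 (\<lambda>xs. fst (prod_decode (xs ! 0)))"
    and recursive_snd_prod_decode: "recursive 1 (\<lambda>xs. snd (prod_decode (xs ! 0)))"
proof -
  have fst_eq: "fst (prod_decode t) = (LEAST y. \<exists>z<Suc t. prod_encode (y, z) = t)" for t
    by (intro Least_equality[symmetric])
      (auto intro!: exI[of _ "snd (prod_decode t)"] simp: less_Suc_eq_le,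
       metis le_prod_encode_2 prod.collapse prod_decode_inverse)
  have snd_eq: "snd (prod_decode t) = (LEAST y. \<exists>z<Suc t. prod_encode (z, y) = t)" for t
    by (intro Least_equality[symmetric])
      (auto intro!: exI[of _ "fst (prod_decode t)"] simp: less_Suc_eq_le,
       metis le_prod_encode_1 prod.collapse prod_decode_inverse)
  have ex: "\<exists>y z. z < Suc t \<and> prod_encode (y, z) = t" "\<exists>y z. z < Suc t \<and> prod_encode (z, y) = t" for t
    by (metis le_imp_less_Suc le_prod_encode_2 prod_decode_inverse surj_pair,
        metis le_imp_less_Suc le_prod_encode_1 prod_decode_inverse surj_pair)
  have bound: "recursive (Suc 1) (\<lambda>xs. Suc (xs ! 1))"
    by (intro recursive_Suc recursive.proj) simp
  \<comment> \<open>The arguments are \<open>z\<close>, \<open>y\<close>, \<open>t\<close>: the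
    bounded component, the component searched for, and the code.\<close>
  have "decidable (Suc (Suc 1)) (\<lambda>xs. prod_encode (xs ! 1, xs ! 0) = xs ! 2)"
    "decidable (Suc (Suc 1)) (\<lambda>xs. prod_encode (xs ! 0, xs ! 1) = xs ! 2)"
    by (intro decidable_eq recursive_prod_encode recursive.proj; simp)+
  from this(1)[THEN decidable_bex, OF bound] this(2)[THEN decidable_bex, OF bound]
  have "decidable (Suc 1) (\<lambda>xs. \<exists>z<Suc (xs ! 1). prod_encode (xs ! 0, z) = xs ! 1)"
    "decidable (Suc 1) (\<lambda>xs. \<exists>z<Suc (xs ! 1). prod_encode (z, xs ! 0) = xs ! 1)"
    by (simp_all add: eval_nat_numeral)
  from this[THEN recursive_Least]
  show "recursive 1 (\<lambda>xs. fst (prod_decode (xs ! 0)))" "recursive 1 (\<lambda>xs. snd (prod_decode (xs ! 0)))"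
    using ex by (simp_all add: fst_eq snd_eq)
qed

text \<open>Iterated pairing: the first component of \<open>t\<close> is the head, and the second
  one encodes the rest. Thus a single number can run through all tuples.\<close>

lemma ex_recursive_tuple_decoding:
  "\<exists>cs. length cs = n \<and> (\<forall>c\<in>set cs. recursive 1 c) \<and>
     (\<forall>xs. length xs = n \<longrightarrow> (\<exists>t. map (\<lambda>c. c [t]) cs = xs))"
proof (induction n)
  case 0
  then show ?case by auto
next
  case (Suc n)
  then obtain cs where cs: "length cs = n" "\<forall>c\<in>set cs. recursive 1 c"
    "\<And>xs. length xs = n \<Longrightarrow> \<exists>t. map (\<lambda>c. c [t]) cs = xs"
    by auto
  let ?cs = "(\<lambda>xs. fst (prod_decode (xs ! 0))) #
    map (\<lambda>c xs. c [snd (prod_decode (xs ! 0))]) cs"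
  have "\<exists>t. map (\<lambda>c. c [t]) ?cs = xs" if len: "length xs = Suc n" for xs
  proof -
    obtain y ys where xs: "xs = y # ys" "length ys = n"
      using len by (auto simp: length_Suc_conv)
    then obtain t where "map (\<lambda>c. c [t]) cs = ys"
      using cs(3) by blast
    then have "map (\<lambda>c. c [prod_encode (y, t)]) ?cs = xs"
      using xs by (simp add: comp_def)
    then show ?thesis by blast
  qed
  moreover have "\<forall>c\<in>set ?cs. recursive 1 c"
    using cs(2) by (auto intro: recursive_fst_prod_decode recursive_comp1[OF _ recursive_snd_prod_decode]
        simp del: One_nat_def)
  ultimately show ?case
    using cs(1) by (intro exI[of _ ?cs]) auto
qed

section \<open>Semi-decidable predicates\<close>

text \<open>Projection form of recursive enumerability: the witness \<open>t\<close> is prepended to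
  the arguments.\<close>

definition semidecidable :: "nat \<Rightarrow> (nat list \<Rightarrow> bool) \<Rightarrow> bool" where
  "semidecidable k P \<longleftrightarrow>
     (\<exists>R. decidable (Suc k) R \<and> (\<forall>xs. length xs = k \<longrightarrow> (P xs \<longleftrightarrow> (\<exists>t. R (t # xs)))))"

lemma semidecidableI:
  "decidable (Suc k) R \<Longrightarrow> (\<And>xs. length xs = k \<Longrightarrow> P xs \<longleftrightarrow> (\<exists>t. R (t # xs))) \<Longrightarrow> semidecidable k P"
  unfolding semidecidable_def by blast

lemma semidecidable_cong:
  assumes "semidecidable k P" "\<And>xs. length xs = k \<Longrightarrow> Q xs \<longleftrightarrow> P xs"
  shows "semidecidable k Q"
  using assms unfolding semidecidable_def by simp

lemma semidecidable_if_decidable: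
  assumes "decidable k P"
  shows "semidecidable k P"
  using decidable_prepend_drop[of "[]" k P 1] assms
  by (intro semidecidableI[where R = "\<lambda>xs. P (drop 1 xs)"]) auto

lemma semidecidable_disj:
  assumes "semidecidable k P" "semidecidable k Q"
  shows "semidecidable k (\<lambda>xs. P xs \<or> Q xs)"
proof -
  obtain R R' where "decidable (Suc k) R" "\<And>xs. length xs = k \<Longrightarrow> P xs \<longleftrightarrow> (\<exists>t. R (t # xs))"
    "decidable (Suc k) R'" "\<And>xs. length xs = k \<Longrightarrow> Q xs \<longleftrightarrow> (\<exists>t. R' (t # xs))"
    using assms unfolding semidecidable_def by blast
  then show ?thesis
    by (intro semidecidableI[OF decidable_disj[of "Suc k" R R']]) auto
qed

text \<open>The two witnesses may differ, so the common \<open>t\<close> is taken as a strict bound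
  for both, and both are searched for below it.\<close>

lemma semidecidable_conj:
  assumes "semidecidable k P" "semidecidable k Q"
  shows "semidecidable k (\<lambda>xs. P xs \<and> Q xs)"
proof -
  have bounded: "decidable (Suc k) (\<lambda>xs. \<exists>y<xs ! 0. R (y # tl xs))"
    if "decidable (Suc k) R" for R
    using decidable_bex[of "Suc k" "\<lambda>xs. R (xs ! 0 # drop 2 xs)", OF _ recursive.proj[of 0]]
      decidable_prepend_drop[of "[\<lambda>xs. xs ! 0]" k R 2] that
    by (simp add: recursive.proj drop_Suc)
  obtain R R' where R: "decidable (Suc k) R" "\<And>xs. length xs = k \<Longrightarrow> P xs \<longleftrightarrow> (\<exists>t. R (t # xs))"
    and R': "decidable (Suc k) R'" "\<And>xs. length xs = k \<Longrightarrow> Q xs \<longleftrightarrow> (\<exists>t. R' (t # xs))"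
    using assms unfolding semidecidable_def by blast
  have eq: "(\<exists>y. A y) \<and> (\<exists>z. B z) \<longleftrightarrow> (\<exists>t. (\<exists>y<t. A y) \<and> (\<exists>z<t. B z))" for A B :: "nat \<Rightarrow> bool"
    by (meson less_add_Suc1 less_add_Suc2)
  show ?thesis
  proof (rule semidecidableI[OF decidable_conj[OF bounded[OF R(1)] bounded[OF R'(1)]]])
    show "P xs \<and> Q xs \<longleftrightarrow> (\<exists>t. (\<exists>y<(t # xs) ! 0. R (y # tl (t # xs))) \<and>
        (\<exists>y<(t # xs) ! 0. R' (y # tl (t # xs))))" if "length xs = k" for xs
      using eq[of "\<lambda>y. R (y # xs)" "\<lambda>y. R' (y # xs)"] that by (simp add: R(2) R'(2))
  qed
qed

text \<open>With \<open>xs = z # t # zs\<close> this says that \<open>R (y # z # zs)\<close> has a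
  witness \<open>y < t\<close>. It serves to bound the witnesses for different \<open>z\<close> by
  one number \<open>t\<close>.\<close>

lemma decidable_bex_second:
  assumes "decidable (Suc (Suc k)) R"
  shows "decidable (Suc (Suc k)) (\<lambda>xs. \<exists>y<xs ! 1. R (y # xs ! 0 # drop 2 xs))"
proof -
  have "decidable (3 + k) (\<lambda>xs. R (map (\<lambda>g. g xs) [\<lambda>xs. xs ! 0, \<lambda>xs. xs ! 1] @ drop 3 xs))"
    using assms by (intro decidable_prepend_drop) (auto intro: recursive.proj)
  then have "decidable (Suc (Suc (Suc k))) (\<lambda>xs. R (xs ! 0 # xs ! 1 # drop 3 xs))"
    by (simp add: eval_nat_numeral)
  from decidable_bex[OF this recursive.proj[of 1]] show ?thesis
    by simp
qed

text \<open>One number \<open>t\<close> bounds both the value \<open>z\<close> and the witness for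
  it.\<close>

lemma semidecidable_ex:
  assumes "semidecidable (Suc k) P"
  shows "semidecidable k (\<lambda>xs. \<exists>z. P (z # xs))"
proof -
  obtain R where R: "decidable (Suc (Suc k)) R"
    "\<And>xs. length xs = Suc k \<Longrightarrow> P xs \<longleftrightarrow> (\<exists>t. R (t # xs))"
    using assms unfolding semidecidable_def by blast
  have "(\<exists>z y. A z y) \<longleftrightarrow> (\<exists>t. \<exists>z<t. \<exists>y<t. A z y)" for A :: "nat \<Rightarrow> nat \<Rightarrow> bool"
    by (meson less_add_Suc1 less_add_Suc2)
  then show ?thesis
    by (intro semidecidableI[OF decidable_bex[OF decidable_bex_second[OF R(1)] recursive.proj[of 0]]])
      (simp_all add: R(2))
qed

text \<open>Finitely many witnesses have a common bound \<open>t\<close>, so the unbounded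
  existential quantifier moves in front of the bounded universal one.\<close>

lemma semidecidable_ball:
  assumes "semidecidable (Suc k) P" "recursive k b"
  shows "semidecidable k (\<lambda>xs. \<forall>i<b xs. P (i # xs))"
proof -
  obtain R where R: "decidable (Suc (Suc k)) R"
    "\<And>xs. length xs = Suc k \<Longrightarrow> P xs \<longleftrightarrow> (\<exists>t. R (t # xs))"
    using assms(1) unfolding semidecidable_def by blast
  have eq: "(\<forall>i<b. \<exists>y. A i y) \<longleftrightarrow> (\<exists>t. \<forall>i<b. \<exists>y<t. A i y)" for A :: "nat \<Rightarrow> nat \<Rightarrow> bool" and b
  proof (induction b)
    case (Suc b)
    show ?case
    proof
      assume all: "\<forall>i<Suc b. \<exists>y. A i y"
      then obtain t y where "\<forall>i<b. \<exists>y<t. A i y" "A b y"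
        using Suc by (meson less_Suc_eq)
      then show "\<exists>t. \<forall>i<Suc b. \<exists>y<t. A i y"
        \<comment> \<open>The sum exceeds the new witness \<open>y\<close> and is at least the old
          bound \<open>t\<close>.\<close>
        by (intro exI[of _ "t + Suc y"]) (metis less_Suc_eq less_add_Suc2 add_Suc_right trans_less_add1)
    qed blast
  qed simp
  show ?thesis
  proof (rule semidecidableI[OF decidable_ball[OF decidable_bex_second[OF R(1)] recursive_tl[OF assms(2)]]])
    show "(\<forall>i<b xs. P (i # xs)) \<longleftrightarrow> (\<exists>t. \<forall>i<b (tl (t # xs)). \<exists>y<(i # t # xs) ! 1.
        R (y # (i # t # xs) ! 0 # drop 2 (i # t # xs)))" if "length xs = k" for xs
      using eq[of "b xs" "\<lambda>i y. R (y # i # xs)"] that by (simp add: R(2))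
  qed
qed

text \<open>The witness is a position in the enumeration of \<open>A\<close>, and the tuples are
  compared componentwise. The empty set has no enumeration and is treated apart.\<close>

lemma semidecidable_mem:
  assumes "recursively_enumerable (length gs) A" "\<forall>g\<in>set gs. recursive k g"
  shows "semidecidable k (\<lambda>xs. map (\<lambda>g. g xs) gs \<in> A)"
proof (cases "A = {}")
  case True
  then show ?thesis
    using semidecidable_if_decidable[OF decidable_const] by simp
next
  case False
  then obtain hs where hs: "length hs = length gs" "\<forall>h\<in>set hs. recursive 1 h"
    and A: "A = range (\<lambda>t. map (\<lambda>h. h [t]) hs)"
    using assms(1) by (auto simp: recursively_enumerable_def)
  have "decidable (Suc k) (\<lambda>ys. map (\<lambda>g. g (tl ys)) gs = map (\<lambda>h. h [ys ! 0]) hs)"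
    using hs assms(2)
  proof (induction hs gs rule: list_induct2)
    case Nil
    then show ?case by (simp add: decidable_const)
  next
    case (Cons h hs g gs)
    then show ?case
      by (auto intro!: decidable_conj decidable_eq recursive_tl recursive_comp1 recursive.proj)
  qed
  then show ?thesis
    by (rule semidecidableI) (auto simp: A)
qed

text \<open>Decode each number into a witness followed by a tuple. If the witness is right, output
  the tuple, otherwise a fixed member \<open>a\<close> of \<open>A\<close>, which keeps the
  enumeration total.\<close>

lemma recursively_enumerable_if_semidecidable:
  assumes "semidecidable n (\<lambda>xs. xs \<in> A)" "\<And>xs. xs \<in> A \<Longrightarrow> length xs = n"
  shows "recursively_enumerable n A"
proof (cases "A = {}")
  case True
  then show ?thesis by (simp add: recursively_enumerable_def)
next
  case False
  then obtain a where a: "a \<in> A" by blast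
  obtain R where R: "decidable (Suc n) R"
    "\<And>xs. length xs = n \<Longrightarrow> xs \<in> A \<longleftrightarrow> (\<exists>t. R (t # xs))"
    using assms(1) unfolding semidecidable_def by blast
  obtain cs where cs: "length cs = Suc n" "\<forall>c\<in>set cs. recursive 1 c"
    and surj: "\<And>xs. length xs = Suc n \<Longrightarrow> \<exists>t. map (\<lambda>c. c [t]) cs = xs"
    using ex_recursive_tuple_decoding[of "Suc n"] by blast
  \<comment> \<open>Position 0 of the decoded list is the witness, so component \<open>i\<close> of
    the tuple sits at \<open>Suc i\<close>.\<close>
  define g where "g i = (\<lambda>xs. if R (map (\<lambda>c. c xs) cs) then (cs ! Suc i) xs else a ! i)" for i
  have map_g: "map (\<lambda>h. h [t]) (map g [0..<n]) =
      (if R (map (\<lambda>c. c [t]) cs) then tl (map (\<lambda>c. c [t]) cs) else a)" for t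
    using assms(2)[OF a] cs(1) by (intro nth_equalityI) (auto simp: g_def nth_tl)
  have "decidable 1 (\<lambda>xs. R (map (\<lambda>c. c xs) cs))"
    using decidable_prepend_drop[of cs 0 R 1] R(1) cs
    by (auto simp: decidable_def)
  then have "\<forall>h\<in>set (map g [0..<n]). recursive 1 h"
    using cs by (auto simp: g_def intro!: recursive_if recursive_const)
  moreover have "A = range (\<lambda>t. map (\<lambda>h. h [t]) (map g [0..<n]))"
  proof (intro equalityI subsetI)
    fix xs assume xs: "xs \<in> A"
    then obtain t where t: "R (t # xs)" using R(2) assms(2) by blast
    obtain s where "map (\<lambda>c. c [s]) cs = t # xs"
      using surj[of "t # xs"] assms(2)[OF xs] by (metis length_Cons)
    then show "xs \<in> range (\<lambda>t. map (\<lambda>h. h [t]) (map g [0..<n]))"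
      unfolding map_g using t by (intro image_eqI[of _ _ s]) auto
  next
    fix xs assume "xs \<in> range (\<lambda>t. map (\<lambda>h. h [t]) (map g [0..<n]))"
    then obtain t where xs: "xs = (if R (map (\<lambda>c. c [t]) cs) then tl (map (\<lambda>c. c [t]) cs) else a)"
      unfolding map_g by blast
    obtain y ys where ys: "map (\<lambda>c. c [t]) cs = y # ys" "length ys = n"
      using cs(1) by (metis length_Suc_conv length_map)
    then show "xs \<in> A" using xs a R(2)[of ys] by (auto split: if_splits)
  qed
  ultimately show ?thesis
    unfolding recursively_enumerable_def
    by (intro disjI2 exI[of _ "map g [0..<n]"]) simp
qed

section \<open>The approximation system\<close>

text \<open>The difference of the radii is brought to the denominator \<open>q * q'\<close>. If the
  subtraction in the numerator truncates to 0, both sides fail: \<open>A\<close> demands a positive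
  numerator, and a distance is never negative.\<close>

lemma mem_dist_less_iff:
  fixes d :: "'a \<Rightarrow> 'a \<Rightarrow> real"
  assumes A: "A = {[l, l', p, q] | l l' p q. l \<in> K \<and> l' \<in> K \<and> 0 < p \<and> 0 < q \<and>
      d (\<alpha> l) (\<alpha> l') < real p / real q}"
    and nonneg: "\<And>x y. 0 \<le> d x y" and pos: "0 < q" "0 < q'"
  shows "[k, k', p' * q - p * q', q * q'] \<in> A \<longleftrightarrow>
    k \<in> K \<and> k' \<in> K \<and> d (\<alpha> k) (\<alpha> k') + real p / real q < real p' / real q'"
proof -
  have eq: "real p' / real q' - real p / real q = (real p' * real q - real p * real q') / real (q * q')"
    using pos by (simp add: field_simps)
  show ?thesis
  proof (cases "p' * q \<le> p * q'")
    case True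
    then have "real p' * real q \<le> real p * real q'"
      by (metis of_nat_le_iff of_nat_mult)
    then have "real p' / real q' - real p / real q \<le> 0"
      unfolding eq by (intro divide_nonpos_nonneg) auto
    then show ?thesis
      using True nonneg[of "\<alpha> k" "\<alpha> k'"] by (auto simp: A)
  next
    case False
    then have "real (p' * q - p * q') / real (q * q') = real p' / real q' - real p / real q"
      unfolding eq by (simp add: of_nat_diff)
    then show ?thesis
      using False pos by (auto simp: A)
  qed
qed

text \<open>Choose the radius below half the smallest slack \<open>r m' - d (\<alpha> k') x\<close>,
  then by density a centre closer to \<open>x\<close> than this radius. The triangle inequality
  costs at most two radii, which is less than the slack.\<close>

lemma (in Metric_space) ex_ball_formally_inside:
  assumes dense: "dense_in_metric M d (\<alpha> ` K)" and K: "\<alpha> \<in> K \<rightarrow> M"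
    and r: "\<forall>\<epsilon>::rat. 0 < \<epsilon> \<longrightarrow> infinite {n. \<bar>r n\<bar> < \<epsilon>}" "\<And>n. 0 < r n"
    and x: "x \<in> M" and fin: "finite D"
    and D: "\<And>k m. (k, m) \<in> D \<Longrightarrow> k \<in> K \<and> d (\<alpha> k) x < of_rat (r m)"
  shows "\<exists>k\<in>K. \<exists>m. d (\<alpha> k) x < of_rat (r m) \<and>
    (\<forall>(k', m')\<in>D. d (\<alpha> k) (\<alpha> k') + of_rat (r m) < of_rat (r m'))"
proof -
  \<comment> \<open>The element 1 gives a minimum also for empty \<open>D\<close>.\<close>
  define gap where "gap = Min (insert 1 ((\<lambda>(k, m). of_rat (r m) - d (\<alpha> k) x) ` D))"
  have "0 < gap"
    unfolding gap_def using fin D by (subst Min_gr_iff) auto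
  moreover have gap: "gap \<le> of_rat (r m) - d (\<alpha> k) x" if "(k, m) \<in> D" for k m
    unfolding gap_def using fin that by (intro Min_le) (auto intro: image_eqI[of _ _ "(k, m)"])
  \<comment> \<open>A rational bound is needed because the accumulation hypothesis speaks of
    rational \<epsilon>.\<close>
  ultimately obtain \<epsilon> where \<epsilon>: "0 < \<epsilon>" "of_rat \<epsilon> < gap / 2"
    by (metis half_gt_zero of_rat_dense zero_less_of_rat_iff)
  then obtain m where "\<bar>r m\<bar> < \<epsilon>"
    using r(1) by (metis (mono_tags, lifting) empty_Collect_eq finite.emptyI)
  then have m: "2 * of_rat (r m) < gap"
    using \<epsilon>(2) r(2)[of m] by (simp add: of_rat_less[of "r m" \<epsilon>, symmetric, where 'a = real])
  have "x \<in> mtopology closure_of (\<alpha> ` K)"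
    using dense x by (simp add: dense_in_metric_def)
  moreover have "0 < real_of_rat (r m)"
    using r(2) by simp
  ultimately obtain k where k: "k \<in> K" "\<alpha> k \<in> mball x (of_rat (r m))"
    unfolding metric_closure_of by blast
  then have near: "d (\<alpha> k) x < of_rat (r m)" "\<alpha> k \<in> M"
    using K by (auto simp: commute)
  have "d (\<alpha> k) (\<alpha> k') + of_rat (r m) < of_rat (r m')" if "(k', m') \<in> D" for k' m'
  proof -
    have "\<alpha> k' \<in> M" using D[OF that] K by blast
    then have "d (\<alpha> k) (\<alpha> k') \<le> d (\<alpha> k) x + d (\<alpha> k') x"
      using triangle[of "\<alpha> k" x "\<alpha> k'"] near(2) x by (simp add: commute)
    then show ?thesis using near(1) m gap[OF that] by linarith
  qed
  then show ?thesis using k(1) near(1) by blast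
qed

theorem theorem3p8:
  fixes X :: "'a set" and d :: "'a \<Rightarrow> 'a \<Rightarrow> real"
    and Y :: "'b set" and e :: "'b \<Rightarrow> 'b \<Rightarrow> real"
    and E :: "'a set" and f :: "'a \<Rightarrow> 'b"
    and K L :: "nat set" and \<alpha> :: "nat \<Rightarrow> 'a" and \<beta> :: "nat \<Rightarrow> 'b"
    and r :: "nat \<Rightarrow> rat" and pair :: "nat \<Rightarrow> nat \<Rightarrow> nat"
    and I J :: "nat set" and U :: "nat \<Rightarrow> 'a set" and V :: "nat \<Rightarrow> 'b set"
  assumes "Metric_space X d" and "Metric_space Y e"
    and "E \<subseteq> X" and "f \<in> E \<rightarrow> Y"
    and "\<alpha> \<in> K \<rightarrow> X" and "\<beta> \<in> L \<rightarrow> Y"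
    and "dense_in_metric X d (\<alpha> ` K)" and "dense_in_metric Y e (\<beta> ` L)"
    and "computable_pos_rat_seq r"
    and "\<forall>\<epsilon>::rat. 0 < \<epsilon> \<longrightarrow> infinite {n. \<bar>r n\<bar> < \<epsilon>}"
    and "recursive 2 (\<lambda>xs. pair (xs ! 0) (xs ! 1))" and "bij (\<lambda>(a, b). pair a b)"
    and "I = {pair k m | k m. k \<in> K}" and "J = {pair l n | l n. l \<in> L}"
    and "\<forall>k\<in>K. \<forall>m. U (pair k m) = Metric_space.mball X d (\<alpha> k) (of_rat (r m))"
    and "\<forall>l\<in>L. \<forall>n. V (pair l n) = Metric_space.mball Y e (\<beta> l) (of_rat (r n))"
    and "semi_computable_metric_space X d K \<alpha>"
    and "recursively_enumerable 1 {[l] | l. l \<in> L}"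
    and "computable_wrt I U J V E f"
  shows "\<exists>S. topological_approximation_system d e K \<alpha> L \<beta> r E f S \<and>
             recursively_enumerable 4 {[k, m, l, n] | k m l n. (k, m, l, n) \<in> S}"
proof -
  interpret X: Metric_space X d by fact
  interpret Y: Metric_space Y e by fact
  obtain p q where pq: "recursive 1 p" "recursive 1 q" "\<And>n. 0 < p [n]" "\<And>n. 0 < q [n]"
    and r: "\<And>n. r n = of_nat (p [n]) / of_nat (q [n])"
    using \<open>computable_pos_rat_seq r\<close> unfolding computable_pos_rat_seq_def by blast
  have r_pos: "0 < r n" for n
    using pq(3,4)[of n] by (simp add: r)
  have r_real: "real_of_rat (r n) = real (p [n]) / real (q [n])" for n
    by (simp add: r of_rat_divide)
  obtain F where F: "enumeration_operator F"
    and FJ: "\<And>x. x \<in> E \<Longrightarrow> indices_at J V (f x) = F (indices_at I U x)"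
    using \<open>computable_wrt I U J V E f\<close> unfolding computable_wrt_def by blast
  obtain W where W: "recursively_enumerable 2 W"
    and FW: "\<And>B. F B = {j. \<exists>u. [j, u] \<in> W \<and> set_decode u \<subseteq> B}"
    using F unfolding enumeration_operator_def by blast
  have comp: "indices_at J V (f x) = {j. \<exists>u. [j, u] \<in> W \<and> set_decode u \<subseteq> indices_at I U x}"
    if "x \<in> E" for x
    using FJ[OF that] FW by simp
  define A where "A = {[l, l', p, q] | l l' p q. l \<in> K \<and> l' \<in> K \<and> 0 < p \<and> 0 < q \<and>
      d (\<alpha> l) (\<alpha> l') < real p / real q}"
  have "recursively_enumerable 4 A"
    using \<open>semi_computable_metric_space X d K \<alpha>\<close>
    unfolding semi_computable_metric_space_def A_def by blast
  then have A: "recursively_enumerable (Suc (Suc (Suc (Suc 0)))) A"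
    by (simp add: eval_nat_numeral)
  \<comment> \<open>Formal inclusion of one ball in another becomes membership in an enumerable set,
    at arguments recursive in the indices.\<close>
  have mem_A: "[k, k', p [m'] * q [m] - p [m] * q [m'], q [m] * q [m']] \<in> A \<longleftrightarrow>
      k \<in> K \<and> k' \<in> K \<and> d (\<alpha> k) (\<alpha> k') + of_rat (r m) < of_rat (r m')" for k m k' m'
    unfolding r_real by (rule mem_dist_less_iff[where d = d and \<alpha> = \<alpha>, OF A_def]) (auto simp: pq)
  \<comment> \<open>Since \<open>d (\<alpha> k) (\<alpha> k) = 0 < 1/1\<close>, the domain
    \<open>K\<close> is read off the diagonal of \<open>A\<close>; this makes
    \<open>k \<in> K\<close> semi-decidable.\<close>
  have mem_A_diag: "[k, k, 1, 1] \<in> A \<longleftrightarrow> k \<in> K" for k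
    using \<open>\<alpha> \<in> K \<rightarrow> X\<close> by (auto simp: A_def Pi_iff)
  have pair_inj: "pair a b = pair a' b' \<longleftrightarrow> a = a' \<and> b = b'" for a b a' b'
    using \<open>bij (\<lambda>(a, b). pair a b)\<close> by (auto simp: bij_def dest: injD[of _ "(a, b)" "(a', b')"])
  have I_iff: "pair k m \<in> indices_at I U x \<longleftrightarrow> k \<in> K \<and> d (\<alpha> k) x < of_rat (r m)"
    if "x \<in> E" for k m x
    using that assms(3,5,13,15) by (auto simp: indices_at_def pair_inj Pi_iff)
  have J_iff: "pair l n \<in> indices_at J V (f x) \<longleftrightarrow> l \<in> L \<and> e (\<beta> l) (f x) < of_rat (r n)"
    if "x \<in> E" for l n x
    using that assms(4,6,14,16) by (auto simp: indices_at_def pair_inj Pi_iff)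
  define inside where "inside k m i \<longleftrightarrow>
    (\<exists>k' m'. i = pair k' m' \<and> k' \<in> K \<and> d (\<alpha> k) (\<alpha> k') + of_rat (r m) < of_rat (r m'))" for k m i
  \<comment> \<open>If \<open>set_decode u\<close> is empty, the condition on \<open>inside\<close>
    is vacuous, so \<open>k \<in> K\<close> is demanded separately.\<close>
  define S where "S = {(k, m, l, n). k \<in> K \<and> l \<in> L \<and>
    (\<exists>u. [pair l n, u] \<in> W \<and> (\<forall>i\<in>set_decode u. inside k m i))}"

  \<comment> \<open>\<open>S\<close> is an approximation system\<close>
  have "topological_approximation_system d e K \<alpha> L \<beta> r E f S"
    unfolding topological_approximation_system_def
  proof (intro conjI ballI allI iffI)
    show "S \<subseteq> K \<times> UNIV \<times> L \<times> UNIV" by (auto simp: S_def)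
  next
    fix x l n assume x: "x \<in> E" and l: "l \<in> L" and "e (\<beta> l) (f x) < of_rat (r n)"
    then have "pair l n \<in> indices_at J V (f x)" by (simp add: J_iff)
    then obtain u where u: "[pair l n, u] \<in> W" "set_decode u \<subseteq> indices_at I U x"
      using comp[OF x] by blast
    let ?D = "{(k, m). pair k m \<in> set_decode u}"
    \<comment> \<open>This is the preimage of a finite set under the injective pairing.\<close>
    have "finite ?D"
      using finite_vimageI[OF finite_set_decode[of u] bij_is_inj[OF assms(12)]]
      by (rule back_subst[of finite]) auto
    moreover have "k \<in> K \<and> d (\<alpha> k) x < of_rat (r m)" if "(k, m) \<in> ?D" for k m
      using that u(2) I_iff[OF x, of k m] by auto
    ultimately obtain k m where km: "k \<in> K" "d (\<alpha> k) x < of_rat (r m)"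
      and D: "\<forall>(k', m')\<in>?D. d (\<alpha> k) (\<alpha> k') + of_rat (r m) < of_rat (r m')"
      using X.ex_ball_formally_inside[OF assms(7,5,10) r_pos, of x ?D] x assms(3) by blast
    have "inside k m i" if i: "i \<in> set_decode u" for i
    proof -
      \<comment> \<open>Membership in \<open>indices_at I U x\<close> forces \<open>i\<close> to be
        an index from \<open>I\<close>, so \<open>?D\<close> accounts for every element of
        \<open>set_decode u\<close>.\<close>
      obtain k' m' where "i = pair k' m'" "k' \<in> K"
        using i u(2) assms(13) by (auto simp: indices_at_def)
      then show ?thesis using i D by (auto simp: inside_def)
    qed
    then show "\<exists>k m. (k, m, l, n) \<in> S \<and> d (\<alpha> k) x < of_rat (r m)"
      using km l u(1) by (auto simp: S_def)
  next
    fix x l n assume x: "x \<in> E" and "l \<in> L"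
      and "\<exists>k m. (k, m, l, n) \<in> S \<and> d (\<alpha> k) x < of_rat (r m)"
    then obtain k m u where k: "k \<in> K" "d (\<alpha> k) x < of_rat (r m)"
      and u: "[pair l n, u] \<in> W" "\<forall>i\<in>set_decode u. inside k m i"
      by (auto simp: S_def)
    have "i \<in> indices_at I U x" if "i \<in> set_decode u" for i
    proof -
      obtain k' m' where i: "i = pair k' m'" "k' \<in> K"
        "d (\<alpha> k) (\<alpha> k') + of_rat (r m) < of_rat (r m')"
        using u(2) \<open>i \<in> set_decode u\<close> by (auto simp: inside_def)
      \<comment> \<open>Formal inclusion implies inclusion: the right-hand side is below
        \<open>d (\<alpha> k) (\<alpha> k') + r m\<close>, hence below \<open>r m'\<close>.\<close>
      have "d (\<alpha> k') x \<le> d (\<alpha> k) (\<alpha> k') + d (\<alpha> k) x"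
        using X.triangle[of "\<alpha> k'" "\<alpha> k" x] k(1) i(2) x assms(3,5) by (auto simp: X.commute Pi_iff)
      then show ?thesis
        using i k(2) by (simp add: I_iff[OF x])
    qed
    then have "pair l n \<in> indices_at J V (f x)"
      using u(1) comp[OF x] by blast
    then show "e (\<beta> l) (f x) < of_rat (r n)"
      by (simp add: J_iff[OF x])
  qed

  \<comment> \<open>\<open>S\<close> is recursively enumerable\<close>
  moreover have "recursively_enumerable 4 {[k, m, l, n] | k m l n. (k, m, l, n) \<in> S}"
  proof (rule recursively_enumerable_if_semidecidable)
    note rec = recursive.proj recursive_const recursive_diff recursive_mult
      recursive_comp1[OF pq(1)] recursive_comp1[OF pq(2)]
    note pair_rec = recursive_comp2[OF assms(11), simplified]
    \<comment> \<open>The arguments are \<open>m'\<close>, \<open>k'\<close>, \<open>i\<close>, \<open>u\<close>, \<open>k\<close>, \<open>m\<close>, \<open>l\<close>, \<open>n\<close>, in this order.\<close>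
    have "semidecidable 8 (\<lambda>xs. xs ! 2 = pair (xs ! 1) (xs ! 0) \<and>
        map (\<lambda>g. g xs) [\<lambda>xs. xs ! 4, \<lambda>xs. xs ! 1,
          \<lambda>xs. p [xs ! 0] * q [xs ! 5] - p [xs ! 5] * q [xs ! 0],
          \<lambda>xs. q [xs ! 5] * q [xs ! 0]] \<in> A)"
      using A by (intro semidecidable_conj semidecidable_mem semidecidable_if_decidable decidable_eq pair_rec)
        (auto intro!: rec)
    then have "semidecidable (Suc 7) (\<lambda>xs. xs ! 2 = pair (xs ! 1) (xs ! 0) \<and>
        [xs ! 4, xs ! 1, p [xs ! 0] * q [xs ! 5] - p [xs ! 5] * q [xs ! 0],
          q [xs ! 5] * q [xs ! 0]] \<in> A)"
      by simp
    \<comment> \<open>Each quantifier binds the first argument and shifts the others down by one: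
      first \<open>m'\<close>, then \<open>k'\<close>.\<close>
    from semidecidable_ex[OF this]
    have "semidecidable (Suc 6) (\<lambda>xs. \<exists>m'. xs ! 1 = pair (xs ! 0) m' \<and>
        [xs ! 3, xs ! 0, p [m'] * q [xs ! 4] - p [xs ! 4] * q [m'], q [xs ! 4] * q [m']] \<in> A)"
      by simp
    from semidecidable_ex[OF this]
    have inside: "semidecidable (Suc 5) (\<lambda>xs. \<exists>k' m'. xs ! 0 = pair k' m' \<and>
        [xs ! 2, k', p [m'] * q [xs ! 3] - p [xs ! 3] * q [m'], q [xs ! 3] * q [m']] \<in> A)"
      by simp
    \<comment> \<open>The restriction to members of \<open>set_decode u\<close> is written as a
      disjunction; its negated part is harmless because membership is decidable.\<close>
    have "semidecidable (Suc 5) (\<lambda>xs. \<not> xs ! 0 \<in> set_decode (xs ! 1))"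
      by (intro semidecidable_if_decidable decidable_not decidable_mem_set_decode recursive.proj) auto
    \<comment> \<open>The remaining arguments are \<open>u\<close>, \<open>k\<close>,
      \<open>m\<close>, \<open>l\<close>, \<open>n\<close>, and \<open>u\<close> itself bounds
      \<open>i\<close>.\<close>
    from semidecidable_ball[OF semidecidable_disj[OF this inside] recursive.proj[of 0]]
    have all_inside: "semidecidable (Suc 4) (\<lambda>xs. \<forall>i<xs ! 0. i \<notin> set_decode (xs ! 0) \<or>
        (\<exists>k' m'. i = pair k' m' \<and>
          [xs ! 1, k', p [m'] * q [xs ! 2] - p [xs ! 2] * q [m'], q [xs ! 2] * q [m']] \<in> A))"
      by simp
    have "semidecidable (Suc 4)
        (\<lambda>xs. map (\<lambda>g. g xs) [\<lambda>xs. pair (xs ! 3) (xs ! 4), \<lambda>xs. xs ! 0] \<in> W)"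
      using W by (intro semidecidable_mem) (auto simp: numeral_2_eq_2 intro!: recursive.proj pair_rec)
    from semidecidable_ex[OF semidecidable_conj[OF this all_inside]]
    have ex_u: "semidecidable 4 (\<lambda>xs. \<exists>u. [pair (xs ! 2) (xs ! 3), u] \<in> W \<and>
        (\<forall>i<u. i \<notin> set_decode u \<or> (\<exists>k' m'. i = pair k' m' \<and>
          [xs ! 0, k', p [m'] * q [xs ! 1] - p [xs ! 1] * q [m'], q [xs ! 1] * q [m']] \<in> A)))"
      by simp
    have K: "semidecidable 4 (\<lambda>xs. map (\<lambda>g. g xs) [\<lambda>xs. xs ! 0, \<lambda>xs. xs ! 0, \<lambda>_. 1, \<lambda>_. 1] \<in> A)"
      using A by (intro semidecidable_mem) (auto intro: rec)
    have L: "semidecidable 4 (\<lambda>xs. map (\<lambda>g. g xs) [\<lambda>xs. xs ! 2] \<in> {[l] | l. l \<in> L})"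
      using assms(18) by (intro semidecidable_mem) (auto intro: rec)
    from semidecidable_conj[OF K semidecidable_conj[OF L ex_u]]
    show "semidecidable 4 (\<lambda>xs. xs \<in> {[k, m, l, n] | k m l n. (k, m, l, n) \<in> S})"
    proof (rule semidecidable_cong)
      fix xs :: "nat list" assume "length xs = 4"
      then obtain k m l n where xs: "xs = [k, m, l, n]"
        by (auto simp: eval_nat_numeral length_Suc_conv)
      have "(\<forall>i\<in>set_decode u. inside k m i) \<longleftrightarrow> (\<forall>i<u. i \<notin> set_decode u \<or> inside k m i)" for u
        using less_if_mem_set_decode by blast
      then show "xs \<in> {[k, m, l, n] | k m l n. (k, m, l, n) \<in> S} \<longleftrightarrow>
        map (\<lambda>g. g xs) [\<lambda>xs. xs ! 0, \<lambda>xs. xs ! 0, \<lambda>_. 1, \<lambda>_. 1] \<in> A \<and>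
        map (\<lambda>g. g xs) [\<lambda>xs. xs ! 2] \<in> {[l] | l. l \<in> L} \<and>
        (\<exists>u. [pair (xs ! 2) (xs ! 3), u] \<in> W \<and>
        (\<forall>i<u. i \<notin> set_decode u \<or> (\<exists>k' m'. i = pair k' m' \<and>
          [xs ! 0, k', p [m'] * q [xs ! 1] - p [xs ! 1] * q [m'], q [xs ! 1] * q [m']] \<in> A)))"
        unfolding xs by (auto simp: S_def mem_A mem_A_diag[simplified] inside_def)
    qed
  qed auto
  ultimately show ?thesis by blast
qed

end
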